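(* Let $q$ be a prime power and $n\ge 1$ an integer. Let $L_1,\dots,L_c$ be lines in $\mathbb{F}_q^n$ and $X=\bigcup_{i=1}^c L_i$. On each $L_i$, pick a subset $\gamma_i\subset L_i$ such that $|\gamma_i|\geq\frac q2$, and let $Y=\bigcup_{i=1}^c\gamma_i$. Then $$ |X| \leq \left(3-\frac 2q\right)^n |Y|. $$
   Context: $\mathbb{F}_q$ is the finite field with $q$ elements. A line is a one-dimensional affine subspace of $\mathbb{F}_q^n$. *)

theory Defs
  imports "HOL-Analysis.Analysis"
begin

definition affine_line :: "('a::field ^ 'n) set \<Rightarrow> bool" where
  "affine_line L \<longleftrightarrow> (\<exists>p V. vec.subspace V \<and> vec.dim V = 1 \<and> L = (\<lambda>v. p + v) ` V)"

end

theory Submission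
  imports Defs
begin

text \<open>
  The method of multiplicities, with the dimension count carried out as an injection between finite
  sets. Over all \<open>x \<in> X\<close> and exponents \<open>b\<close> with \<open>|b| \<le> K\<close>, the polynomials
  \<open>\<Prod>i. (z i - x i) ^ b i * (\<Prod>u \<noteq> x i. (z i - u) ^ (b i + 1))\<close>
  have degree at most \<open>d = K q + n (q - 1)\<close>, and a combination of them whose Hasse derivatives up to
  order \<open>K\<close> vanish on \<open>X\<close> is trivial. If the derivatives up to order \<open>R\<close> vanish on \<open>Y\<close>, then a
  derivative of order \<open>j \<le> K\<close>, restricted to a line, has degree at most \<open>d - j\<close> and at least \<open>q/2\<close>
  zeros of multiplicity \<open>R + 1 - j\<close>, so it vanishes on the line as soon as
  \<open>d - j < (R + 1 - j) q/2\<close>; this allows \<open>R \<approx> (3 - 2/q) K\<close>. Hence the coefficients of a combination are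
  determined by its derivatives up to order \<open>R\<close> on \<open>Y\<close>, so \<open>|X|\<close> times the number of \<open>\<alpha>\<close> with
  \<open>|\<alpha>| \<le> K\<close> is at most \<open>|Y|\<close> times the number with \<open>|\<alpha>| \<le> R\<close>. Let \<open>K\<close> tend to infinity.
\<close>

section \<open>Counting exponent vectors of bounded total degree\<close>

text \<open>Induction on the support \<open>I\<close>: fixing the value \<open>k\<close> at the new
  index leaves the budget \<open>K - k\<close>, and the hockey-stick identity sums the
  counts.\<close>

lemma card_bounded_sum_functions:
  assumes "finite I"
  shows "finite {f :: 'i \<Rightarrow> nat. (\<forall>i. i \<notin> I \<longrightarrow> f i = 0) \<and> sum f I \<le> K} \<and>
         card {f :: 'i \<Rightarrow> nat. (\<forall>i. i \<notin> I \<longrightarrow> f i = 0) \<and> sum f I \<le> K} = (K + card I) choose card I"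
  using assms
proof (induction I arbitrary: K)
  case empty
  have "{f :: 'i \<Rightarrow> nat. (\<forall>i. i \<notin> {} \<longrightarrow> f i = 0) \<and> sum f {} \<le> K} = {\<lambda>_. 0}"
    by auto
  then show ?case
    by simp
next
  case (insert i I)
  define A where "A J M = {f :: 'i \<Rightarrow> nat. (\<forall>i. i \<notin> J \<longrightarrow> f i = 0) \<and> sum f J \<le> M}" for J M
  have bij: "bij_betw (\<lambda>(k, f). f(i := k)) (SIGMA k:{..K}. A I (K - k)) (A (insert i I) K)"
  proof (rule bij_betw_byWitness[where f' = "\<lambda>g. (g i, g(i := 0))"])
    have upd: "sum (f(i := k)) I = sum f I" for f :: "'i \<Rightarrow> nat" and k
      using insert.hyps by (intro sum.cong) auto
    show "(\<lambda>(k, f). f(i := k)) ` (SIGMA k:{..K}. A I (K - k)) \<subseteq> A (insert i I) K"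
      using insert.hyps upd[unfolded fun_upd_def] by (auto simp: A_def)
    show "(\<lambda>g. (g i, g(i := 0))) ` A (insert i I) K \<subseteq> (SIGMA k:{..K}. A I (K - k))"
      using insert.hyps upd[unfolded fun_upd_def] by (auto simp: A_def)
  qed (use insert.hyps in \<open>auto simp: A_def fun_eq_iff\<close>)
  have fin: "finite (SIGMA k:{..K}. A I (K - k))"
    using insert.IH by (auto simp: A_def)
  have "card (A (insert i I) K) = card (SIGMA k:{..K}. A I (K - k))"
    using bij_betw_same_card[OF bij] by simp
  also have "\<dots> = (\<Sum>k\<le>K. (K - k + card I) choose card I)"
    using insert.IH by (subst card_SigmaI) (auto simp: A_def)
  also have "\<dots> = (\<Sum>k\<le>K. (k + card I) choose card I)"
    by (rule sum.reindex_bij_witness[where i = "\<lambda>k. K - k" and j = "\<lambda>k. K - k"]) auto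
  also have "\<dots> = (\<Sum>k\<le>K. (card I + k) choose k)"
    by (intro sum.cong refl) (simp add: add.commute binomial_symmetric[of "card I"])
  also have "\<dots> = Suc (card I + K) choose K"
    by (rule sum_choose_lower)
  also have "\<dots> = (K + card (insert i I)) choose card (insert i I)"
    using insert.hyps by (simp add: add.commute binomial_symmetric[of K])
  finally have "card (A (insert i I) K) = (K + card (insert i I)) choose card (insert i I)" .
  moreover have "finite (A (insert i I) K)"
    using bij_betw_finite[OF bij] fin by simp
  ultimately show ?case
    by (simp add: A_def)
qed

text \<open>Comparison factor by factor; it bounds the number of exponents from below by its leading
  term in \<open>K\<close>.\<close>

lemma power_le_fact_binomial: "(K + 1) ^ n \<le> fact n * ((K + n) choose n)"
proof (induction n)
  case (Suc n)
  have "(K + 1) ^ Suc n \<le> (K + Suc n) * (fact n * ((K + n) choose n))"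
    using mult_le_mono[OF _ Suc.IH, of "K + 1" "K + Suc n"] by simp
  also have "\<dots> = fact n * (Suc (K + n) * ((K + n) choose n))"
    by (simp add: algebra_simps)
  also have "\<dots> = fact (Suc n) * ((K + Suc n) choose Suc n)"
    unfolding Suc_times_binomial_eq by (simp add: algebra_simps)
  finally show ?case .
qed simp

section \<open>Hasse derivatives and multiplicities in one variable\<close>

text \<open>The binomial coefficient replaces the falling factorial of the ordinary derivative, so
  that orders at or above the characteristic still carry information.\<close>

definition hasse_deriv :: "nat \<Rightarrow> 'a::comm_ring_1 poly \<Rightarrow> 'a poly" where
  "hasse_deriv k p = (\<Sum>l\<le>degree p. monom (of_nat ((k + l) choose k) * coeff p (k + l)) l)"

lemma coeff_hasse_deriv: "coeff (hasse_deriv k p) l = of_nat ((k + l) choose k) * coeff p (k + l)"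
  by (auto simp: hasse_deriv_def coeff_sum coeff_eq_0 if_distrib[of "\<lambda>x. x = _"])

lemma degree_hasse_deriv_le: "degree (hasse_deriv k p) \<le> degree p - k"
  by (intro degree_le) (auto simp: coeff_hasse_deriv coeff_eq_0)

lemma hasse_deriv_eq_0: "degree p < k \<Longrightarrow> hasse_deriv k p = 0"
  by (intro poly_eqI) (simp add: coeff_hasse_deriv coeff_eq_0)

lemma hasse_deriv_add: "hasse_deriv k (p + q) = hasse_deriv k p + hasse_deriv k q"
  by (intro poly_eqI) (simp add: coeff_hasse_deriv algebra_simps)

lemma hasse_deriv_smult: "hasse_deriv k (smult c p) = smult c (hasse_deriv k p)"
  by (intro poly_eqI) (simp add: coeff_hasse_deriv algebra_simps)

lemma hasse_deriv_0 [simp]: "hasse_deriv 0 p = p"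
  by (intro poly_eqI) (simp add: coeff_hasse_deriv)

text \<open>The Leibniz rule for multiplication by the variable; on coefficients it is Pascal's
  rule.\<close>

lemma hasse_deriv_Suc_pCons:
  "hasse_deriv (Suc k) (pCons c p) = pCons 0 (hasse_deriv (Suc k) p) + hasse_deriv k p"
  by (intro poly_eqI) (auto simp: coeff_hasse_deriv coeff_pCons algebra_simps binomial_eq_0 split: nat.splits)

lemma hasse_deriv_pcompose_translate:
  "hasse_deriv k (p \<circ>\<^sub>p [:t, 1:]) = hasse_deriv k p \<circ>\<^sub>p [:t, 1:]"
proof (induction p arbitrary: k)
  case (pCons c p)
  have translate: "pCons c p \<circ>\<^sub>p [:t, 1:] = pCons c (p \<circ>\<^sub>p [:t, 1:]) + smult t (p \<circ>\<^sub>p [:t, 1:])"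
    by (simp add: pcompose_pCons)
  show ?case
  proof (cases k)
    case (Suc j)
    show ?thesis
      unfolding translate Suc
      by (simp add: hasse_deriv_add hasse_deriv_smult hasse_deriv_Suc_pCons pCons.IH
            pcompose_add pcompose_pCons algebra_simps)
  qed simp
qed (simp add: hasse_deriv_def)

text \<open>Since the derivative commutes with translation, this Taylor expansion only has to be
  checked at 0.\<close>

lemma poly_hasse_deriv: "poly (hasse_deriv k p) t = coeff (p \<circ>\<^sub>p [:t, 1:]) k"
proof -
  have "coeff (hasse_deriv k p \<circ>\<^sub>p [:t, 1:]) 0 = coeff (p \<circ>\<^sub>p [:t, 1:]) k"
    by (simp add: coeff_hasse_deriv flip: hasse_deriv_pcompose_translate)
  then show ?thesis
    by simp
qed

lemma eq_0_if_many_roots: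
  fixes p :: "'a::idom poly"
  assumes "finite T" and "\<And>t. t \<in> T \<Longrightarrow> [:-t, 1:] ^ k dvd p" and "degree p < k * card T"
  shows "p = 0"
proof (rule ccontr)
  assume "p \<noteq> 0"
  have "k * card T = (\<Sum>t\<in>T. k)"
    by simp
  also have "\<dots> \<le> (\<Sum>t\<in>T. count (proots p) t)"
    using assms(2) \<open>p \<noteq> 0\<close> by (intro sum_mono) (simp add: order_divides)
  also have "\<dots> \<le> (\<Sum>t\<in>T \<union> set_mset (proots p). count (proots p) t)"
    using assms(1) by (intro sum_mono2) auto
  also have "\<dots> = size (proots p)"
    unfolding size_multiset_overloaded_eq using assms(1)
    by (intro sum.mono_neutral_right) (auto simp: count_eq_zero_iff simp del: set_count_proots)
  also have "\<dots> \<le> degree p"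
    by (rule size_proots_le)
  finally show False
    using assms(3) by simp
qed

text \<open>The common degree bound \<open>N\<close> makes the set of exponent choices
  finite.\<close>

lemma coeff_prod:
  fixes f :: "'i \<Rightarrow> 'a::comm_ring_1 poly"
  assumes "finite I" and "\<And>i. i \<in> I \<Longrightarrow> degree (f i) \<le> N"
  shows "coeff (\<Prod>i\<in>I. f i) k =
    (\<Sum>l\<in>PiE I (\<lambda>_. {..N}). if sum l I = k then \<Prod>i\<in>I. coeff (f i) (l i) else 0)"
proof -
  have monoms: "(\<Prod>i\<in>I. monom (c i) (l i)) = monom (prod c I) (sum l I)" for c :: "'i \<Rightarrow> 'a" and l
    using assms(1) by induction (auto simp: mult_monom one_pCons monom_0)
  have "(\<Prod>i\<in>I. f i) = (\<Prod>i\<in>I. \<Sum>l\<le>N. monom (coeff (f i) l) l)"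
    using assms(2) by (simp add: poly_as_sum_of_monoms')
  also have "\<dots> = (\<Sum>l\<in>PiE I (\<lambda>_. {..N}). \<Prod>i\<in>I. monom (coeff (f i) (l i)) (l i))"
    using assms(1) by (intro prod_sum_PiE) auto
  finally show ?thesis
    by (simp add: monoms coeff_sum)
qed

lemma pcompose_power: "(p ^ n) \<circ>\<^sub>p q = (p \<circ>\<^sub>p q) ^ n"
  by (induction n) (simp_all add: pcompose_mult pcompose_1)

lemma linear_power_dvd_if_coeff_translate:
  fixes p :: "'a::comm_ring_1 poly"
  assumes "\<And>k. k < m \<Longrightarrow> coeff (p \<circ>\<^sub>p [:t, 1:]) k = 0"
  shows "[:-t, 1:] ^ m dvd p"
proof -
  have "monom 1 m dvd p \<circ>\<^sub>p [:t, 1:]"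
    using assms by (simp add: monom_1_dvd_iff')
  then obtain r where "p \<circ>\<^sub>p [:t, 1:] = [:0, 1:] ^ m * r"
    by (auto simp: monom_altdef)
  then have "p \<circ>\<^sub>p [:t, 1:] \<circ>\<^sub>p [:-t, 1:] = [:-t, 1:] ^ m * (r \<circ>\<^sub>p [:-t, 1:])"
    by (simp add: pcompose_mult pcompose_power pcompose_pCons)
  moreover have "p \<circ>\<^sub>p [:t, 1:] \<circ>\<^sub>p [:-t, 1:] = p"
    by (simp add: pcompose_pCons flip: pcompose_assoc)
  ultimately show ?thesis
    by simp
qed

section \<open>Multivariate derivatives restricted to lines\<close>

text \<open>
  The Hasse derivative of order \<open>\<alpha>\<close> at \<open>x\<close> of the polynomial \<open>\<Sum>s\<in>S. c s * (\<Prod>i. h s i (z i))\<close> in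
  the variables \<open>z i\<close>: every multivariate polynomial needed here is such a combination of products of
  univariate ones.
\<close>
definition multi_deriv ::
    "'s set \<Rightarrow> ('s \<Rightarrow> 'a) \<Rightarrow> ('s \<Rightarrow> 'n \<Rightarrow> 'a poly) \<Rightarrow> ('n \<Rightarrow> nat) \<Rightarrow> 'a::comm_ring_1 ^ 'n::finite \<Rightarrow> 'a" where
  "multi_deriv S c h \<alpha> x = (\<Sum>s\<in>S. c s * (\<Prod>i\<in>UNIV. coeff (h s i \<circ>\<^sub>p [:x $ i, 1:]) (\<alpha> i)))"

text \<open>By \<open>less\<close>, the restriction \<open>Q\<close> of the derivative to the line
  has more zeros on \<open>T\<close>, with multiplicity, than its degree allows. So \<open>Q\<close>
  is zero and vanishes at every \<open>t\<close>, in \<open>T\<close> or not.\<close>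

lemma multi_deriv_vanishes_on_line:
  fixes c :: "'s \<Rightarrow> 'a::idom" and h :: "'s \<Rightarrow> 'n::finite \<Rightarrow> 'a poly"
  assumes "finite S" "finite T"
    and deg: "\<And>s. s \<in> S \<Longrightarrow> (\<Sum>i\<in>UNIV. degree (h s i)) \<le> d"
    and van: "\<And>t \<alpha>. t \<in> T \<Longrightarrow> sum \<alpha> UNIV \<le> R \<Longrightarrow> multi_deriv S c h \<alpha> (p + t *s v) = 0"
    and less: "d - sum \<beta> UNIV < (R + 1 - sum \<beta> UNIV) * card T"
  shows "multi_deriv S c h \<beta> (p + t *s v) = 0"
proof -
  define Q where
    "Q = (\<Sum>s\<in>S. smult (c s) (\<Prod>i\<in>UNIV. hasse_deriv (\<beta> i) (h s i) \<circ>\<^sub>p [:p $ i, v $ i:]))"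
  have poly_Q: "poly Q u = multi_deriv S c h \<beta> (p + u *s v)" for u
    by (simp add: Q_def multi_deriv_def poly_sum poly_prod poly_pcompose poly_hasse_deriv)
  have deg_i: "degree (h s i) \<le> d" if "s \<in> S" for s i
    using deg[OF that] member_le_sum[of i UNIV "\<lambda>i. degree (h s i)"] by simp
  have "degree (\<Prod>i\<in>UNIV. hasse_deriv (\<beta> i) (h s i) \<circ>\<^sub>p [:p $ i, v $ i:]) \<le> d - sum \<beta> UNIV"
    if "s \<in> S" for s
  \<comment> \<open>Subtraction is truncated: if some \<open>\<beta> i\<close> exceeds its degree,
    summing the differences may not give the bound, but then the product is 0.\<close>
  proof (cases "\<forall>i. \<beta> i \<le> degree (h s i)")
    case True
    have "degree (\<Prod>i\<in>UNIV. hasse_deriv (\<beta> i) (h s i) \<circ>\<^sub>p [:p $ i, v $ i:])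
      \<le> (\<Sum>i\<in>UNIV. degree (hasse_deriv (\<beta> i) (h s i) \<circ>\<^sub>p [:p $ i, v $ i:]))"
      by (rule order_trans[OF degree_prod_sum_le]) auto
    also have "\<dots> \<le> (\<Sum>i\<in>UNIV. degree (h s i) - \<beta> i)"
    proof (rule sum_mono)
      fix i
      have "degree (hasse_deriv (\<beta> i) (h s i) \<circ>\<^sub>p [:p $ i, v $ i:]) \<le> degree (hasse_deriv (\<beta> i) (h s i))"
        by (rule order_trans[OF degree_pcompose_le]) simp
      also have "\<dots> \<le> degree (h s i) - \<beta> i"
        by (rule degree_hasse_deriv_le)
      finally show "degree (hasse_deriv (\<beta> i) (h s i) \<circ>\<^sub>p [:p $ i, v $ i:]) \<le> degree (h s i) - \<beta> i" .
    qed
    also have "\<dots> = (\<Sum>i\<in>UNIV. degree (h s i)) - sum \<beta> UNIV"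
      using True by (intro sum_subtractf_nat) auto
    finally show ?thesis
      using deg[OF that] by simp
  next
    case False
    then obtain i where "degree (h s i) < \<beta> i"
      by (auto simp: not_le)
    then have "(\<Prod>i\<in>UNIV. hasse_deriv (\<beta> i) (h s i) \<circ>\<^sub>p [:p $ i, v $ i:]) = 0"
      by (intro prod_zero bexI[of _ i]) (auto simp: hasse_deriv_eq_0)
    then show ?thesis
      by (simp only: degree_0 le0)
  qed
  then have deg_Q: "degree Q \<le> d - sum \<beta> UNIV"
    unfolding Q_def using assms(1) by (intro degree_sum_le order_trans[OF degree_smult_le])
  have "[:-u, 1:] ^ (R + 1 - sum \<beta> UNIV) dvd Q" if "u \<in> T" for u
  proof (rule linear_power_dvd_if_coeff_translate)
    fix k assume k: "k < R + 1 - sum \<beta> UNIV"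
    define x where "x = p + u *s v"
    define F where "F s i = hasse_deriv (\<beta> i) (h s i) \<circ>\<^sub>p [:p $ i, v $ i:] \<circ>\<^sub>p [:u, 1:]" for s i
    \<comment> \<open>The weight joins the chain rule factors \<open>v $ i\<close> with the
      binomials from composing derivatives of orders \<open>\<beta> i\<close> and
      \<open>l i\<close>.\<close>
    define w where "w l = (\<Prod>i\<in>UNIV. (v $ i) ^ l i * of_nat ((\<beta> i + l i) choose \<beta> i))" for l
    have F: "F s i = hasse_deriv (\<beta> i) (h s i \<circ>\<^sub>p [:x $ i, 1:]) \<circ>\<^sub>p [:0, v $ i:]" for s i
      by (simp add: F_def x_def hasse_deriv_pcompose_translate pcompose_pCons mult.commute
          flip: pcompose_assoc)
    \<comment> \<open>Expanding at \<open>u\<close>, the coefficient of degree \<open>k\<close> is a combination of derivatives at \<open>x\<close> of order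
      \<open>|\<beta>| + k \<le> R\<close>.\<close>
    have coeff_F: "coeff (F s i) l =
      (v $ i) ^ l * of_nat ((\<beta> i + l) choose \<beta> i) * coeff (h s i \<circ>\<^sub>p [:x $ i, 1:]) (\<beta> i + l)" for s i l
      by (simp add: F coeff_pcompose_linear coeff_hasse_deriv mult.assoc)
    have deg_F: "degree (F s i) \<le> d" if "s \<in> S" for s i
    proof -
      have "degree (F s i) \<le> degree (hasse_deriv (\<beta> i) (h s i))"
        unfolding F_def
        by (rule order_trans[OF degree_pcompose_le], rule order_trans[OF mult_right_mono, OF degree_pcompose_le])
          auto
      with degree_hasse_deriv_le[of "\<beta> i" "h s i"] deg_i[OF that, of i] show ?thesis
        by linarith
    qed
    have "coeff (Q \<circ>\<^sub>p [:u, 1:]) k = (\<Sum>s\<in>S. c s * coeff (\<Prod>i\<in>UNIV. F s i) k)"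
      by (simp add: Q_def F_def pcompose_sum pcompose_smult pcompose_prod coeff_sum)
    also have "\<dots> = (\<Sum>s\<in>S. c s * (\<Sum>l\<in>UNIV \<rightarrow>\<^sub>E {..d}.
        if sum l UNIV = k then \<Prod>i\<in>UNIV. coeff (F s i) (l i) else 0))"
      by (intro sum.cong refl) (subst coeff_prod[where N = d], auto simp: deg_F)
    also have "\<dots> = (\<Sum>s\<in>S. \<Sum>l\<in>UNIV \<rightarrow>\<^sub>E {..d}. if sum l UNIV = k
        then w l * (c s * (\<Prod>i\<in>UNIV. coeff (h s i \<circ>\<^sub>p [:x $ i, 1:]) (\<beta> i + l i))) else 0)"
      unfolding sum_distrib_left
      by (intro sum.cong refl) (auto simp: coeff_F w_def prod.distrib mult_ac)
    also have "\<dots> = (\<Sum>l\<in>UNIV \<rightarrow>\<^sub>E {..d}. if sum l UNIV = k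
        then w l * multi_deriv S c h (\<lambda>i. \<beta> i + l i) x else 0)"
      by (subst sum.swap, intro sum.cong refl) (auto simp: multi_deriv_def sum_distrib_left)
    also have "\<dots> = 0"
      using van[OF that] k by (intro sum.neutral) (auto simp: x_def sum.distrib)
    finally show "coeff (Q \<circ>\<^sub>p [:u, 1:]) k = 0" .
  qed
  then have "Q = 0"
    using deg_Q less assms(2) by (intro eq_0_if_many_roots[where T = T and k = "R + 1 - sum \<beta> UNIV"]) auto
  then show ?thesis
    using poly_Q[of t] by simp
qed

section \<open>Interpolation polynomials and their independence\<close>

text \<open>Among the Hasse derivatives of order at most \<open>b\<close> at all points of the
  field, exactly one is nonzero: that of order \<open>b\<close> at \<open>x\<close>.\<close>

definition interp_poly :: "'a \<Rightarrow> nat \<Rightarrow> 'a::{field,finite} poly" where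
  "interp_poly x b = [:-x, 1:] ^ b * (\<Prod>u\<in>UNIV - {x}. [:-u, 1:] ^ (b + 1))"

lemma degree_interp_poly:
  "degree (interp_poly (x :: 'a::{field,finite}) b) = b * CARD('a) + (CARD('a) - 1)"
proof -
  have "degree (interp_poly x b) = b + (\<Sum>u\<in>UNIV - {x}. b + 1)"
    unfolding interp_poly_def
    by (subst degree_mult_eq) (auto simp: degree_power_eq degree_prod_eq_sum_degree simp del: power_Suc)
  also have "\<dots> = b + (CARD('a) - 1) * (b + 1)"
    by (simp add: card_Diff_singleton)
  also have "\<dots> = b * (1 + (CARD('a) - 1)) + (CARD('a) - 1)"
    by (simp only: distrib_left distrib_right mult.commute mult_1_right mult_1_left add.assoc)
  also have "1 + (CARD('a) - 1) = CARD('a)"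
    using zero_less_card_finite[where 'a = 'a] by simp
  finally show ?thesis .
qed

lemma interp_poly_translate:
  "interp_poly x b \<circ>\<^sub>p [:y, 1:] = [:y - x, 1:] ^ b * (\<Prod>u\<in>UNIV - {x}. [:y - u, 1:] ^ (b + 1))"
  by (simp add: interp_poly_def pcompose_mult pcompose_prod pcompose_power pcompose_pCons del: power_Suc)

lemma coeff_interp_poly_same: "coeff (interp_poly x b \<circ>\<^sub>p [:x, 1:]) b \<noteq> 0"
proof -
  let ?r = "\<Prod>u\<in>UNIV - {x}. [:x - u, 1:] ^ (b + 1)"
  have "coeff (interp_poly x b \<circ>\<^sub>p [:x, 1:]) b = coeff (monom 1 b * ?r) b"
    by (simp add: interp_poly_translate monom_altdef del: power_Suc)
  also have "\<dots> = poly ?r 0"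
    by (simp add: coeff_monom_mult poly_0_coeff_0)
  also have "\<dots> \<noteq> 0"
    by (simp add: poly_prod)
  finally show ?thesis .
qed

lemma coeff_interp_poly_eq_0:
  assumes "a < b \<or> y \<noteq> x \<and> a \<le> b"
  shows "coeff (interp_poly x b \<circ>\<^sub>p [:y, 1:]) a = 0"
proof -
  have "monom 1 (if y = x then b else b + 1) dvd interp_poly x b \<circ>\<^sub>p [:y, 1:]"
  proof (cases "y = x")
    case False
    then have "[:y - y, 1:] ^ (b + 1) dvd (\<Prod>u\<in>UNIV - {x}. [:y - u, 1:] ^ (b + 1))"
      by (intro dvd_prodI) auto
    then show ?thesis
      using False by (simp add: interp_poly_translate monom_altdef del: power_Suc)
  qed (simp add: interp_poly_translate monom_altdef)
  then show ?thesis
    using assms by (auto simp: monom_1_dvd_iff' split: if_splits)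
qed

definition interp_family :: "('a ^ 'n) \<times> ('n \<Rightarrow> nat) \<Rightarrow> 'n \<Rightarrow> 'a::{field,finite} poly" where
  "interp_family s i = interp_poly (fst s $ i) (snd s i)"

definition multi_indices :: "nat \<Rightarrow> ('n::finite \<Rightarrow> nat) set" where
  "multi_indices K = {\<alpha>. sum \<alpha> UNIV \<le> K}"

lemma
  shows finite_multi_indices [simp]: "finite (multi_indices K :: ('n::finite \<Rightarrow> nat) set)"
    and card_multi_indices: "card (multi_indices K :: ('n \<Rightarrow> nat) set) = (K + CARD('n)) choose CARD('n)"
  using card_bounded_sum_functions[of "UNIV :: 'n set" K] by (simp_all add: multi_indices_def)

lemma interp_family_independent:
  fixes X :: "('a::{field,finite} ^ 'n::finite) set"
  assumes van: "\<And>x \<alpha>. x \<in> X \<Longrightarrow> \<alpha> \<in> multi_indices K \<Longrightarrow>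
      multi_deriv (X \<times> multi_indices K) e interp_family \<alpha> x = 0"
    and "x \<in> X" "b \<in> multi_indices K"
  shows "e (x, b) = 0"
  using assms(2,3)
proof (induction "sum b UNIV" arbitrary: x b rule: less_induct)
  case less
  let ?term = "\<lambda>s. e s * (\<Prod>i\<in>UNIV. coeff (interp_family s i \<circ>\<^sub>p [:x $ i, 1:]) (b i))"
  \<comment> \<open>The vanishing conditions are triangular with respect to \<open>|b|\<close>.\<close>
  have zero: "?term s = 0" if s: "s \<in> X \<times> multi_indices K" "s \<noteq> (x, b)" for s
  proof (rule ccontr)
    obtain y b' where [simp]: "s = (y, b')"
      by (cases s)
    assume nz: "?term s \<noteq> 0"
    \<comment> \<open>By induction, \<open>e\<close> already vanishes at all indices of order
      smaller than that of \<open>b\<close>.\<close>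
    then have "sum b UNIV \<le> sum b' UNIV"
      using less.hyps[of b' y] s by (auto simp: not_le[symmetric])
    moreover have nth: "b' i \<le> b i \<and> (x $ i \<noteq> y $ i \<longrightarrow> b' i < b i)" for i
    proof -
      have "coeff (interp_family s i \<circ>\<^sub>p [:x $ i, 1:]) (b i) \<noteq> 0"
        using nz by auto
      then show ?thesis
        using coeff_interp_poly_eq_0[of "b i" "b' i" "x $ i" "y $ i"]
        by (fastforce simp: interp_family_def)
    qed
    \<comment> \<open>A pointwise inequality with the reverse inequality of sums forces equality;
      \<open>nth\<close> then excludes any coordinate where \<open>x\<close> and \<open>y\<close>
      differ.\<close>
    ultimately have eq: "b' i = b i" for i
      using sum_strict_mono_ex1[of UNIV b' b] by (metis UNIV_I finite leD order_le_less)
    with nth have "y = x"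
      by (auto simp: vec_eq_iff)
    with eq s(2) show False
      by auto
  qed
  have "0 = (\<Sum>s\<in>X \<times> multi_indices K. ?term s)"
    using van[OF less.prems] by (simp add: multi_deriv_def)
  also have "\<dots> = ?term (x, b)"
  proof -
    have "(\<Sum>s\<in>X \<times> multi_indices K - {(x, b)}. ?term s) = 0"
      by (rule sum.neutral) (use zero in blast)
    then show ?thesis
      using less.prems by (subst sum.remove[of _ "(x, b)"]) simp_all
  qed
  finally show ?case
    by (auto simp: interp_family_def coeff_interp_poly_same)
qed

section \<open>The counting inequality\<close>

lemma card_times_binomial_le:
  fixes X Y :: "('a::{field,finite} ^ 'n::finite) set"
  assumes lines: "\<And>x. x \<in> X \<Longrightarrow>
      \<exists>p v t T. x = p + t *s v \<and> (\<lambda>u. p + u *s v) ` T \<subseteq> Y \<and> g \<le> card T"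
    and less: "\<And>j. j \<le> K \<Longrightarrow> K * CARD('a) + CARD('n) * (CARD('a) - 1) - j < (R + 1 - j) * g"
  shows "card X * ((K + CARD('n)) choose CARD('n)) \<le> card Y * ((R + CARD('n)) choose CARD('n))"
proof -
  define S where "S = X \<times> (multi_indices K :: ('n \<Rightarrow> nat) set)"
  define Z where "Z = Y \<times> (multi_indices R :: ('n \<Rightarrow> nat) set)"
  define ev where
    "ev c = (\<lambda>(y, \<alpha>)\<in>Z. multi_deriv S c interp_family \<alpha> y)" for c :: "_ \<Rightarrow> 'a"
  have fin: "finite S" "finite Z"
    by (simp_all add: S_def Z_def)
  have deg: "(\<Sum>i\<in>UNIV. degree (interp_family s i)) \<le> K * CARD('a) + CARD('n) * (CARD('a) - 1)"
    if "s \<in> S" for s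
  proof -
    have "(\<Sum>i\<in>UNIV. degree (interp_family s i)) =
        sum (snd s) UNIV * CARD('a) + CARD('n) * (CARD('a) - 1)"
      unfolding interp_family_def degree_interp_poly by (simp only: sum.distrib sum_distrib_right sum_constant of_nat_id)
    then show ?thesis
      using that by (auto simp: S_def multi_indices_def)
  qed
  \<comment> \<open>By linearity it suffices that a difference \<open>e\<close> with zero values on
    \<open>Z\<close> is zero: the lines carry the vanishing from \<open>Y\<close> to
    \<open>X\<close>, and independence finishes.\<close>
  have "inj_on ev (S \<rightarrow>\<^sub>E UNIV)"
  proof (rule inj_onI)
    fix c c' assume c: "c \<in> S \<rightarrow>\<^sub>E UNIV" "c' \<in> S \<rightarrow>\<^sub>E UNIV" and eq: "ev c = ev c'"
    define e where "e s = c s - c' s" for s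
    have e: "multi_deriv S e interp_family \<alpha> y =
        multi_deriv S c interp_family \<alpha> y - multi_deriv S c' interp_family \<alpha> y" for \<alpha> y
      by (simp add: multi_deriv_def e_def sum_subtractf algebra_simps)
    have van: "multi_deriv S e interp_family \<alpha> y = 0" if "y \<in> Y" "sum \<alpha> UNIV \<le> R" for \<alpha> y
      using fun_cong[OF eq, of "(y, \<alpha>)"] that by (simp add: ev_def Z_def multi_indices_def e)
    have "multi_deriv S e interp_family \<alpha> x = 0" if "x \<in> X" "\<alpha> \<in> multi_indices K" for x \<alpha>
    proof -
      obtain p v t T where x: "x = p + t *s v"
        and T: "(\<lambda>u. p + u *s v) ` T \<subseteq> Y" "g \<le> card T"
        using lines[OF \<open>x \<in> X\<close>] by blast
      have "sum \<alpha> UNIV \<le> K"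
        using that by (simp add: multi_indices_def)
      then have less': "K * CARD('a) + CARD('n) * (CARD('a) - 1) - sum \<alpha> UNIV < (R + 1 - sum \<alpha> UNIV) * card T"
        using less T(2) by (meson less_le_trans mult_le_mono2)
      show ?thesis
        unfolding x
      proof (rule multi_deriv_vanishes_on_line[OF fin(1) _ deg _ less'])
        show "finite T"
          by simp
        show "multi_deriv S e interp_family \<delta> (p + u *s v) = 0" if "u \<in> T" "sum \<delta> UNIV \<le> R" for u \<delta>
          using van T(1) that by blast
      qed
    qed
    then have "e s = 0" if "s \<in> S" for s
      using interp_family_independent[of X K e] that by (auto simp: S_def)
    then show "c = c'"
      using c by (intro PiE_ext) (auto simp: e_def)
  qed
  moreover have "ev ` (S \<rightarrow>\<^sub>E UNIV) \<subseteq> Z \<rightarrow>\<^sub>E UNIV"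
    by (auto simp: ev_def)
  ultimately have "card (S \<rightarrow>\<^sub>E (UNIV :: 'a set)) \<le> card (Z \<rightarrow>\<^sub>E (UNIV :: 'a set))"
    using fin by (intro card_inj_on_le) (auto intro: finite_PiE)
  then have "CARD('a) ^ card S \<le> CARD('a) ^ card Z"
    using fin by (simp add: card_funcsetE)
  \<comment> \<open>With at least two field elements, the inequality of powers passes to the
    exponents.\<close>
  moreover have "card {0, 1 :: 'a} \<le> CARD('a)"
    by (intro card_mono) auto
  ultimately have "card S \<le> card Z"
    by simp
  then show ?thesis
    by (simp add: S_def Z_def card_cartesian_product card_multi_indices)
qed

section \<open>Lines, the choice of the order \<open>R\<close>, and the limit\<close>

lemma affine_line_parametrization:
  fixes L :: "('a::field ^ 'n::finite) set"
  assumes "affine_line L"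
  obtains p v where "L \<subseteq> range (\<lambda>t. p + t *s v)"
proof -
  obtain p V where V: "vec.dim V = 1" "L = (\<lambda>v. p + v) ` V"
    using assms by (auto simp: affine_line_def)
  obtain B where "V \<subseteq> vec.span B" "card B = vec.dim V"
    by (rule vec.basis_exists)
  with V obtain v where "V \<subseteq> vec.span {v}"
    by (auto simp: card_1_singleton_iff)
  then have "L \<subseteq> range (\<lambda>t. p + t *s v)"
    using V(2) by (auto simp: vec.span_singleton)
  then show ?thesis
    by (rule that)
qed

text \<open>With \<open>q / 2\<close> for \<open>g\<close>, the condition reads
  \<open>2 * (K * q + n * (q - 1)) + j * (q - 2) < q * (R + 1)\<close>. The worst case is
  \<open>j = K\<close>, and \<open>R\<close> is the least value that meets it.\<close>

lemma half_multiplicity_bound: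
  fixes q n K j g :: nat
  assumes "2 \<le> q" "q \<le> 2 * g" "j \<le> K"
  defines "R \<equiv> (K * (3 * q - 2) + 2 * n * (q - 1)) div q"
  shows "K * q + n * (q - 1) - j < (R + 1 - j) * g"
proof -
  obtain r where r: "q = r + 2"
    using assms(1) by (metis add.commute le_Suc_ex)
  have "K * (3 * q - 2) + 2 * n * (q - 1) < q * (R + 1)"
    unfolding R_def using assms(1) dividend_less_times_div[of q "K * (3 * q - 2) + 2 * n * (q - 1)"] by simp
  then have R: "2 * (K * q + n * (q - 1)) + K * r < q * (R + 1)"
    by (simp add: r algebra_simps)
  have "K * q < (R + 1) * q"
    using R by (simp add: algebra_simps)
  then have "K < R + 1"
    using assms(1) mult_less_cancel2 by blast
  then obtain m where m: "R + 1 = j + m"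
    using assms(3) by (metis le_Suc_ex less_imp_le order_trans)
  have split: "q * (j + m) = j * r + 2 * j + q * m"
    by (simp add: r algebra_simps)
  have "j * r \<le> K * r"
    using assms(3) by simp
  then have "2 * (K * q + n * (q - 1)) < 2 * j + q * m"
    using R[unfolded m] split by linarith
  also have "q * m \<le> 2 * (m * g)"
    using mult_le_mono1[OF assms(2), of m] by (simp add: algebra_simps)
  finally have "K * q + n * (q - 1) < j + m * g"
    by simp
  \<comment> \<open>This rules out truncation when \<open>j\<close> is subtracted.\<close>
  moreover have "j \<le> K * q + n * (q - 1)"
    using assms(1,3) by (metis le_add1 mult_le_mono nat_mult_1_right order_trans one_le_numeral)
  ultimately show ?thesis
    using m by simp
qed

text \<open>Division by \<open>(K + 1) ^ n\<close> and passage to the limit leave the leading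
  coefficients; \<open>C\<close> drops out.\<close>

lemma le_power_if_asymptotically:
  fixes a b \<kappa> C :: real
  assumes "\<And>K::nat. a * (real K + 1) ^ n \<le> b * (\<kappa> * real K + C) ^ n"
  shows "a \<le> b * \<kappa> ^ n"
proof -
  have "(\<lambda>K. b * (\<kappa> + (C - \<kappa>) * inverse (real (Suc K))) ^ n) \<longlonglongrightarrow> b * (\<kappa> + (C - \<kappa>) * 0) ^ n"
    by (intro tendsto_intros LIMSEQ_inverse_real_of_nat)
  moreover have "a \<le> b * (\<kappa> + (C - \<kappa>) * inverse (real (Suc K))) ^ n" for K
  proof -
    have "\<kappa> + (C - \<kappa>) * inverse (real (Suc K)) = (\<kappa> * real K + C) / (real K + 1)"
      by (simp add: field_simps)
    then show ?thesis
      using assms[of K] by (simp add: power_divide field_simps)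
  qed
  ultimately show ?thesis
    by (auto intro: LIMSEQ_le_const)
qed

theorem corollary6p7:
  fixes L \<gamma> :: "nat \<Rightarrow> ('a::{field,finite} ^ 'n::finite) set"
    and q n c :: nat
    and X Y :: "('a ^ 'n) set"
  assumes q: "q = CARD('a)"
    and n: "n = CARD('n)"
    and lines: "\<And>i. i \<in> {1..c} \<Longrightarrow> affine_line (L i)"
    and X: "X = (\<Union>i\<in>{1..c}. L i)"
    and subset: "\<And>i. i \<in> {1..c} \<Longrightarrow> \<gamma> i \<subseteq> L i"
    and large: "\<And>i. i \<in> {1..c} \<Longrightarrow> real (card (\<gamma> i)) \<ge> real q / 2"
    and Y: "Y = (\<Union>i\<in>{1..c}. \<gamma> i)"
  shows "real (card X) \<le> (3 - 2 / real q) ^ n * real (card Y)"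
proof -
  \<comment> \<open>This is \<open>q / 2\<close> rounded up, as the number of chosen points is an
    integer.\<close>
  define g where "g = (q + 1) div 2"
  have "card {0, 1 :: 'a} \<le> CARD('a)"
    by (intro card_mono) auto
  then have q2: "2 \<le> q"
    by (simp add: q)
  have line: "\<exists>p v t T. x = p + t *s v \<and> (\<lambda>u. p + u *s v) ` T \<subseteq> Y \<and> g \<le> card T"
    if x: "x \<in> X" for x
  proof -
    obtain i where i: "i \<in> {1..c}" "x \<in> L i"
      using x unfolding X by blast
    obtain p v where L: "L i \<subseteq> range (\<lambda>t. p + t *s v)"
      using affine_line_parametrization[OF lines[OF i(1)]] .
    \<comment> \<open>The full preimage maps onto \<open>\<gamma> i\<close>, so it has at least as
      many elements.\<close>
    define T where "T = {u. p + u *s v \<in> \<gamma> i}"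
    have "\<gamma> i = (\<lambda>u. p + u *s v) ` T"
      using subset[OF i(1)] L by (auto simp: T_def)
    then have "card (\<gamma> i) \<le> card T"
      by (simp add: card_image_le)
    then have "g \<le> card T"
      using large[OF i(1)] by (simp add: g_def)
    moreover obtain t where "x = p + t *s v"
      using L i(2) by blast
    moreover have "(\<lambda>u. p + u *s v) ` T \<subseteq> Y"
      using i(1) by (auto simp: T_def Y)
    ultimately show ?thesis
      by blast
  qed
  have "real (card X) * (real K + 1) ^ n \<le> real (card Y) * ((3 - 2 / real q) * real K + 3 * real n) ^ n" for K
  proof -
    define R where "R = (K * (3 * q - 2) + 2 * n * (q - 1)) div q"
    have "K * q + n * (q - 1) - j < (R + 1 - j) * g" if "j \<le> K" for j
      unfolding R_def using q2 that by (intro half_multiplicity_bound) (auto simp: g_def)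
    then have "card X * ((K + n) choose n) \<le> card Y * ((R + n) choose n)"
      using card_times_binomial_le[OF line] by (simp only: q n)
    \<comment> \<open>After multiplication by \<open>fact n\<close>, the binomials compare with
      \<open>n\<close>-th powers, from below on the left and from above on the right.\<close>
    then have "fact n * ((K + n) choose n) * card X \<le> ((R + n) choose n) * fact n * card Y"
      by (simp add: mult.commute mult.left_commute)
    moreover have "(K + 1) ^ n * card X \<le> fact n * ((K + n) choose n) * card X"
      by (intro mult_right_mono power_le_fact_binomial) simp
    moreover have "((R + n) choose n) * fact n * card Y \<le> (R + n) ^ n * card Y"
      by (intro mult_right_mono binomial_fact_pow) simp
    ultimately have "(K + 1) ^ n * card X \<le> (R + n) ^ n * card Y"
      by linarith
    then have "real ((K + 1) ^ n * card X) \<le> real ((R + n) ^ n * card Y)"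
      by (rule of_nat_mono)
    then have "real (card X) * (real K + 1) ^ n \<le> real (card Y) * (real R + real n) ^ n"
      by (simp add: mult.commute add.commute)
    \<comment> \<open>The constant \<open>3 * real n\<close> collects at most
      \<open>2 * real n\<close> from \<open>R\<close> and the \<open>real n\<close> added to
      it.\<close>
    also have "\<dots> \<le> real (card Y) * ((3 - 2 / real q) * real K + 3 * real n) ^ n"
    proof (intro mult_left_mono power_mono)
      have "real R \<le> real (K * (3 * q - 2) + 2 * n * (q - 1)) / real q"
        unfolding R_def by (rule of_nat_div_le_of_nat)
      also have "\<dots> = (3 - 2 / real q) * real K + 2 * real n * (1 - 1 / real q)"
        using q2 by (simp add: of_nat_diff field_simps)
      also have "\<dots> \<le> (3 - 2 / real q) * real K + 2 * real n"
        using q2 by (simp add: field_simps)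
      finally show "real R + real n \<le> (3 - 2 / real q) * real K + 3 * real n"
        by simp
    qed auto
    finally show ?thesis .
  qed
  from le_power_if_asymptotically[OF this] show ?thesis
    by (simp add: mult.commute)
qed

end
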